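(* Let $\mathcal{T}$ be a triangulated category with a metric $\{B_n\}_{n\in\mathbb{N}}$ and let $\{C_n\}_{n\in\mathbb{N}}$ be its improvement. Then $\{C_n\}_{n\in\mathbb{N}}$ is the coarsest good metric (up to equivalence of metrics) which is finer than $\{B_n\}_{n\in\mathbb{N}}$; that is, $\{C_n\}_{n\in\mathbb{N}}$ is a good metric finer than $\{B_n\}_{n\in\mathbb{N}}$, and every good metric on $\mathcal{T}$ that is finer than $\{B_n\}_{n\in\mathbb{N}}$ is finer than $\{C_n\}_{n\in\mathbb{N}}$.
   Context: $\mathbb{N}=\{1,2,\dots\}$. All subcategories are full. Let $\mathcal{T}$ be a triangulated category with shift $\Sigma$. For subcategories $\mathcal{X},\mathcal{Z}\subseteq\mathcal{T}$, $\mathcal{X}*\mathcal{Z}$ is the subcategory of all objects $T$ admitting a distinguished triangle $X\to T\to Z\to\Sigma X$ with $X\in\mathcal{X}$, $Z\in\mathcal{Z}$. A metric on $\mathcal{T}$ is a non-increasing chain $B_1\supseteq B_2\supseteq\cdots$ of subcategories of $\mathcal{T}$ with $B_n*B_n=B_n$ and $0\in B_n$ for all $n$. It is good if $\Sigma^{-1}B_{n+1}\cup B_{n+1}\cup\Sigma B_{n+1}\subseteq B_n$ for all $n$. A metric $\{C_n\}$ is finer than a metric $\{B_n\}$ (and $\{B_n\}$ is coarser than $\{C_n\}$) if for every $n\in\mathbb{N}$ there is $m\in\mathbb{N}$ with $C_m\subseteq B_n$. Two metrics are equivalent if each is finer than the other. The improvement of a metric $\{B_n\}$ is the sequence $\{C_n\}$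 of subcategories defined by $C_1:=B_1$ and $C_n:=B_n\cap\Sigma C_{n-1}\cap\Sigma^{-1}C_{n-1}$ for $n>1$. *)

theory Defs
  imports "HOL-Algebra.Group"
begin

section \<open>Categories\<close>

record ('o, 'a) category =
  Ob :: "'o set"
  Ar :: "'a set"
  Dom :: "'a \<Rightarrow> 'o"
  Cod :: "'a \<Rightarrow> 'o"
  Id :: "'o \<Rightarrow> 'a"
  Comp :: "'a \<Rightarrow> 'a \<Rightarrow> 'a"  (infixr "\<cdot>\<index>" 70)

definition Hom :: "('o, 'a, 'z) category_scheme \<Rightarrow> 'o \<Rightarrow> 'o \<Rightarrow> 'a set" where
  "Hom C X Y = {f \<in> Ar C. Dom C f = X \<and> Cod C f = Y}"

locale category =
  fixes C :: "('o, 'a, 'z) category_scheme" (structure)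
  assumes Dom_Ob: "f \<in> Ar C \<Longrightarrow> Dom C f \<in> Ob C"
    and Cod_Ob: "f \<in> Ar C \<Longrightarrow> Cod C f \<in> Ob C"
    and Id_Hom: "X \<in> Ob C \<Longrightarrow> Id C X \<in> Hom C X X"
    and Comp_Hom: "\<lbrakk>f \<in> Hom C X Y; g \<in> Hom C Y Z\<rbrakk> \<Longrightarrow> g \<cdot> f \<in> Hom C X Z"
    and Comp_Id: "f \<in> Hom C X Y \<Longrightarrow> f \<cdot> Id C X = f"
    and Id_Comp: "f \<in> Hom C X Y \<Longrightarrow> Id C Y \<cdot> f = f"
    and Comp_assoc: "\<lbrakk>f \<in> Hom C W X; g \<in> Hom C X Y; h \<in> Hom C Y Z\<rbrakk> \<Longrightarrow>
      (h \<cdot> g) \<cdot> f = h \<cdot> (g \<cdot> f)"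

definition is_iso :: "('o, 'a, 'z) category_scheme \<Rightarrow> 'a \<Rightarrow> bool" where
  "is_iso C f \<longleftrightarrow> f \<in> Ar C \<and>
    (\<exists>g \<in> Hom C (Cod C f) (Dom C f).
      g \<cdot>\<^bsub>C\<^esub> f = Id C (Dom C f) \<and> f \<cdot>\<^bsub>C\<^esub> g = Id C (Cod C f))"

definition isomorphic :: "('o, 'a, 'z) category_scheme \<Rightarrow> 'o \<Rightarrow> 'o \<Rightarrow> bool" where
  "isomorphic C X Y \<longleftrightarrow> (\<exists>f \<in> Hom C X Y. is_iso C f)"

definition is_zero_object :: "('o, 'a, 'z) category_scheme \<Rightarrow> 'o \<Rightarrow> bool" where
  "is_zero_object C Z \<longleftrightarrow> Z \<in> Ob C \<and>
    (\<forall>X \<in> Ob C. (\<exists>!f. f \<in> Hom C X Z) \<and> (\<exists>!f. f \<in> Hom C Z X))"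


section \<open>Additive categories\<close>

record ('o, 'a) additive_category = "('o, 'a) category" +
  Add :: "'a \<Rightarrow> 'a \<Rightarrow> 'a"  (infixl "\<oplus>\<index>" 65)
  Zero :: "'o \<Rightarrow> 'o \<Rightarrow> 'a"

text \<open>The additive group of morphisms, written as a multiplicative HOL-Algebra group.\<close>

definition Hom_group ::
  "('o, 'a, 'z) additive_category_scheme \<Rightarrow> 'o \<Rightarrow> 'o \<Rightarrow> 'a monoid" where
  "Hom_group C X Y = \<lparr>carrier = Hom C X Y, monoid.mult = Add C, one = Zero C X Y\<rparr>"

definition Neg :: "('o, 'a, 'z) additive_category_scheme \<Rightarrow> 'a \<Rightarrow> 'a" where
  "Neg C f = inv\<^bsub>Hom_group C (Dom C f) (Cod C f)\<^esub> f"

locale additive_category = category C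
  for C :: "('o, 'a, 'z) additive_category_scheme" (structure) +
  assumes Hom_comm_group: "\<lbrakk>X \<in> Ob C; Y \<in> Ob C\<rbrakk> \<Longrightarrow> comm_group (Hom_group C X Y)"
    and Comp_Add_left: "\<lbrakk>f \<in> Hom C X Y; g \<in> Hom C Y Z; g' \<in> Hom C Y Z\<rbrakk> \<Longrightarrow>
      (g \<oplus> g') \<cdot> f = (g \<cdot> f) \<oplus> (g' \<cdot> f)"
    and Comp_Add_right: "\<lbrakk>f \<in> Hom C X Y; f' \<in> Hom C X Y; g \<in> Hom C Y Z\<rbrakk> \<Longrightarrow>
      g \<cdot> (f \<oplus> f') = (g \<cdot> f) \<oplus> (g \<cdot> f')"
    and ex_zero_object: "\<exists>Z. is_zero_object C Z"
    and ex_biproduct: "\<lbrakk>X \<in> Ob C; Y \<in> Ob C\<rbrakk> \<Longrightarrow>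
      \<exists>P \<in> Ob C. \<exists>i \<in> Hom C X P. \<exists>j \<in> Hom C Y P. \<exists>p \<in> Hom C P X. \<exists>q \<in> Hom C P Y.
        p \<cdot> i = Id C X \<and> q \<cdot> j = Id C Y \<and> p \<cdot> j = Zero C Y X \<and> q \<cdot> i = Zero C X Y \<and>
        (i \<cdot> p) \<oplus> (j \<cdot> q) = Id C P"


section \<open>Triangulated categories\<close>

text \<open>A triangle \<open>X \<rightarrow> Y \<rightarrow> Z \<rightarrow> \<Sigma>X\<close> is given by its three morphisms; \<open>Dist\<close> is the class of
  distinguished triangles.\<close>

record ('o, 'a) triangulated_category = "('o, 'a) additive_category" +
  Shift :: "'o \<Rightarrow> 'o"
  Shift_ar :: "'a \<Rightarrow> 'a"
  Dist :: "('a \<times> 'a \<times> 'a) set"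

definition is_triangle ::
  "('o, 'a, 'z) triangulated_category_scheme \<Rightarrow> 'a \<Rightarrow> 'a \<Rightarrow> 'a \<Rightarrow> bool" where
  "is_triangle T f g h \<longleftrightarrow>
    (\<exists>X Y Z. f \<in> Hom T X Y \<and> g \<in> Hom T Y Z \<and> h \<in> Hom T Z (Shift T X))"

text \<open>The shift is only required to be an autoequivalence (fully faithful and essentially
  surjective); the case of an automorphism is included.\<close>

locale triangulated_category = additive_category T
  for T :: "('o, 'a, 'z) triangulated_category_scheme" (structure) +
  assumes Shift_Ob: "X \<in> Ob T \<Longrightarrow> Shift T X \<in> Ob T"
    and Shift_Id: "X \<in> Ob T \<Longrightarrow> Shift_ar T (Id T X) = Id T (Shift T X)"
    and Shift_Comp: "\<lbrakk>f \<in> Hom T X Y; g \<in> Hom T Y Z\<rbrakk> \<Longrightarrow>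
      Shift_ar T (g \<cdot> f) = Shift_ar T g \<cdot> Shift_ar T f"
    and Shift_Add: "\<lbrakk>f \<in> Hom T X Y; g \<in> Hom T X Y\<rbrakk> \<Longrightarrow>
      Shift_ar T (f \<oplus> g) = Shift_ar T f \<oplus> Shift_ar T g"
    and Shift_fully_faithful: "\<lbrakk>X \<in> Ob T; Y \<in> Ob T\<rbrakk> \<Longrightarrow>
      bij_betw (Shift_ar T) (Hom T X Y) (Hom T (Shift T X) (Shift T Y))"
    and Shift_ess_surj: "Y \<in> Ob T \<Longrightarrow> \<exists>X \<in> Ob T. isomorphic T (Shift T X) Y"
    and Dist_triangle: "(f, g, h) \<in> Dist T \<Longrightarrow> is_triangle T f g h"
    and TR1_iso: "\<lbrakk>(f, g, h) \<in> Dist T; is_triangle T f' g' h';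
        a \<in> Hom T (Dom T f) (Dom T f'); b \<in> Hom T (Dom T g) (Dom T g');
        c \<in> Hom T (Dom T h) (Dom T h'); is_iso T a; is_iso T b; is_iso T c;
        b \<cdot> f = f' \<cdot> a; c \<cdot> g = g' \<cdot> b; Shift_ar T a \<cdot> h = h' \<cdot> c\<rbrakk> \<Longrightarrow>
      (f', g', h') \<in> Dist T"
    and TR1_id: "\<lbrakk>X \<in> Ob T; is_zero_object T Z\<rbrakk> \<Longrightarrow>
      (Id T X, Zero T X Z, Zero T Z (Shift T X)) \<in> Dist T"
    and TR1_cone: "f \<in> Ar T \<Longrightarrow> \<exists>g h. (f, g, h) \<in> Dist T"
    and TR2: "is_triangle T f g h \<Longrightarrow>
      (f, g, h) \<in> Dist T \<longleftrightarrow> (g, h, Neg T (Shift_ar T f)) \<in> Dist T"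
    and TR3: "\<lbrakk>(f, g, h) \<in> Dist T; (f', g', h') \<in> Dist T;
        a \<in> Hom T (Dom T f) (Dom T f'); b \<in> Hom T (Dom T g) (Dom T g');
        b \<cdot> f = f' \<cdot> a\<rbrakk> \<Longrightarrow>
      \<exists>c \<in> Hom T (Dom T h) (Dom T h'). c \<cdot> g = g' \<cdot> b \<and> Shift_ar T a \<cdot> h = h' \<cdot> c"
    and TR4: "\<lbrakk>f \<in> Hom T X Y; g \<in> Hom T Y Z; (f, f\<^sub>1, f\<^sub>2) \<in> Dist T;
        (g, g\<^sub>1, g\<^sub>2) \<in> Dist T; (g \<cdot> f, h\<^sub>1, h\<^sub>2) \<in> Dist T\<rbrakk> \<Longrightarrow>
      \<exists>u v. (u, v, Shift_ar T f\<^sub>1 \<cdot> g\<^sub>2) \<in> Dist T \<and>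
        u \<in> Hom T (Dom T f\<^sub>2) (Dom T h\<^sub>2) \<and> v \<in> Hom T (Dom T h\<^sub>2) (Dom T g\<^sub>2) \<and>
        u \<cdot> f\<^sub>1 = h\<^sub>1 \<cdot> g \<and> h\<^sub>2 \<cdot> u = f\<^sub>2 \<and> v \<cdot> h\<^sub>1 = g\<^sub>1 \<and> g\<^sub>2 \<cdot> v = Shift_ar T f \<cdot> h\<^sub>2"


section \<open>Metrics\<close>

text \<open>Full subcategories are represented by their sets of objects.\<close>

definition star ::
  "('o, 'a, 'z) triangulated_category_scheme \<Rightarrow> 'o set \<Rightarrow> 'o set \<Rightarrow> 'o set" where
  "star T \<X> \<Z> = {Y. \<exists>X \<in> \<X>. \<exists>Z \<in> \<Z>. \<exists>f g h. (f, g, h) \<in> Dist T \<and>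
    f \<in> Hom T X Y \<and> g \<in> Hom T Y Z \<and> h \<in> Hom T Z (Shift T X)}"

text \<open>\<open>\<Sigma>\<X>\<close> and \<open>\<Sigma>\<^sup>-\<^sup>1\<X>\<close> are the essential images of \<open>\<X>\<close> under the shift and under a quasi-inverse
  of it: an object \<open>Y\<close> is isomorphic to \<open>\<Sigma>\<^sup>-\<^sup>1X\<close> iff \<open>\<Sigma>Y\<close> is isomorphic to \<open>X\<close>.  If the shift is an
  automorphism and \<open>\<X>\<close> is closed under isomorphism, as the members of a metric are, these are the
  image and the preimage of \<open>\<X>\<close> under the shift.\<close>

definition shift_sub ::
  "('o, 'a, 'z) triangulated_category_scheme \<Rightarrow> 'o set \<Rightarrow> 'o set" where
  "shift_sub T \<X> = {Y \<in> Ob T. \<exists>X \<in> \<X>. isomorphic T Y (Shift T X)}"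

definition unshift_sub ::
  "('o, 'a, 'z) triangulated_category_scheme \<Rightarrow> 'o set \<Rightarrow> 'o set" where
  "unshift_sub T \<X> = {Y \<in> Ob T. \<exists>X \<in> \<X>. isomorphic T (Shift T Y) X}"

text \<open>Metrics are indexed by the positive integers; the value at index \<open>0\<close> is irrelevant.\<close>

definition is_metric ::
  "('o, 'a, 'z) triangulated_category_scheme \<Rightarrow> (nat \<Rightarrow> 'o set) \<Rightarrow> bool" where
  "is_metric T B \<longleftrightarrow> (\<forall>n \<ge> 1. B n \<subseteq> Ob T \<and> B (n + 1) \<subseteq> B n \<and> star T (B n) (B n) = B n \<and>
    (\<forall>Z. is_zero_object T Z \<longrightarrow> Z \<in> B n))"

definition is_good_metric ::
  "('o, 'a, 'z) triangulated_category_scheme \<Rightarrow> (nat \<Rightarrow> 'o set) \<Rightarrow> bool" where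
  "is_good_metric T B \<longleftrightarrow> is_metric T B \<and>
    (\<forall>n \<ge> 1. unshift_sub T (B (n + 1)) \<union> B (n + 1) \<union> shift_sub T (B (n + 1)) \<subseteq> B n)"

definition finer :: "(nat \<Rightarrow> 'o set) \<Rightarrow> (nat \<Rightarrow> 'o set) \<Rightarrow> bool" where
  "finer C B \<longleftrightarrow> (\<forall>n \<ge> 1. \<exists>m \<ge> 1. C m \<subseteq> B n)"

fun improvement ::
  "('o, 'a, 'z) triangulated_category_scheme \<Rightarrow> (nat \<Rightarrow> 'o set) \<Rightarrow> nat \<Rightarrow> 'o set" where
  "improvement T B 0 = undefined"
| "improvement T B (Suc 0) = B 1"
| "improvement T B (Suc (Suc n)) =
    B (Suc (Suc n)) \<inter> shift_sub T (improvement T B (Suc n)) \<inter>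
    unshift_sub T (improvement T B (Suc n))"

end

theory Submission
  imports Defs
begin

text \<open>
  Every member of a metric contains the zero objects and is closed under extensions
  (\<open>S * S \<subseteq> S\<close>).  This property alone carries the proof.  It forces closure under
  isomorphism, since an isomorphism \<open>X \<rightarrow> Y\<close> sits in a distinguished triangle \<open>X \<rightarrow> Y \<rightarrow> 0 \<rightarrow> \<Sigma>X\<close>,
  and it upgrades \<open>S * S \<subseteq> S\<close> to an equality, since \<open>X \<rightarrow> X \<rightarrow> 0 \<rightarrow> \<Sigma>X\<close> is distinguished.  It is
  stable under intersections, and also under \<open>\<Sigma>\<close> and \<open>\<Sigma>\<^sup>-\<^sup>1\<close>: three rotations show that a triangle
  \<open>(f, g, h)\<close> is distinguished iff \<open>(-\<Sigma>f, -\<Sigma>g, -\<Sigma>h)\<close> is, so distinguished triangles can be moved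
  along the autoequivalence \<open>\<Sigma>\<close> in both directions.  Hence all terms of the improvement
  inherit it, and the improvement \<open>{C\<^sub>n}\<close> is a metric.

  The improvement is good because \<open>C\<^sub>n\<^sub>+\<^sub>1 \<subseteq> \<Sigma>C\<^sub>n\<close> means \<open>\<Sigma>\<^sup>-\<^sup>1C\<^sub>n\<^sub>+\<^sub>1 \<subseteq> C\<^sub>n\<close> for the isomorphism-closed
  \<open>C\<^sub>n\<close>, and symmetrically for \<open>\<Sigma>\<close>.  It is the coarsest good one because goodness of \<open>{D\<^sub>n}\<close> says
  exactly that \<open>D\<^sub>m\<^sub>+\<^sub>1 \<subseteq> \<Sigma>D\<^sub>m \<inter> \<Sigma>\<^sup>-\<^sup>1D\<^sub>m\<close>: if \<open>D\<^sub>m \<subseteq> C\<^sub>n\<close> and \<open>D\<^sub>k \<subseteq> B\<^sub>n\<^sub>+\<^sub>1\<close>, then \<open>D\<^sub>l \<subseteq> C\<^sub>n\<^sub>+\<^sub>1\<close> for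
  \<open>l = max (m + 1) k\<close>, and induction on \<open>n\<close> applies.
\<close>

section \<open>Isomorphisms\<close>

lemma isomorphicI:
  assumes "f \<in> Hom C X Y" "g \<in> Hom C Y X"
    and "g \<cdot>\<^bsub>C\<^esub> f = Id C X" "f \<cdot>\<^bsub>C\<^esub> g = Id C Y"
  shows "isomorphic C X Y"
  using assms unfolding isomorphic_def is_iso_def Hom_def by auto

lemma isomorphicE:
  assumes "isomorphic C X Y"
  obtains f g where "f \<in> Hom C X Y" "g \<in> Hom C Y X"
    "g \<cdot>\<^bsub>C\<^esub> f = Id C X" "f \<cdot>\<^bsub>C\<^esub> g = Id C Y"
  using assms unfolding isomorphic_def is_iso_def Hom_def by auto

lemma is_isoI:
  assumes "f \<in> Hom C X Y" "g \<in> Hom C Y X"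
    and "g \<cdot>\<^bsub>C\<^esub> f = Id C X" "f \<cdot>\<^bsub>C\<^esub> g = Id C Y"
  shows "is_iso C f"
  using assms unfolding is_iso_def Hom_def by auto

lemma isomorphic_sym: "isomorphic C X Y \<Longrightarrow> isomorphic C Y X"
  by (erule isomorphicE) (rule isomorphicI)

context category
begin

lemma Hom_Ob:
  assumes "f \<in> Hom C X Y"
  shows "X \<in> Ob C" "Y \<in> Ob C"
  using assms Dom_Ob Cod_Ob unfolding Hom_def by auto

lemma isomorphic_refl: "X \<in> Ob C \<Longrightarrow> isomorphic C X X"
  by (rule isomorphicI[OF Id_Hom Id_Hom]) (simp_all add: Comp_Id[OF Id_Hom])

lemma Comp_cancel_middle:
  assumes f: "f \<in> Hom C X Y" and g: "g \<in> Hom C Y Z" and g': "g' \<in> Hom C Z Y"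
    and f': "f' \<in> Hom C Y W" and inv: "g' \<cdot> g = Id C Y"
  shows "(f' \<cdot> g') \<cdot> (g \<cdot> f) = f' \<cdot> f"
proof -
  have "(f' \<cdot> g') \<cdot> (g \<cdot> f) = f' \<cdot> (g' \<cdot> (g \<cdot> f))"
    using Comp_assoc[OF Comp_Hom[OF f g] g' f'] .
  also have "g' \<cdot> (g \<cdot> f) = f"
    using Comp_assoc[OF f g g'] inv Id_Comp[OF f] by simp
  finally show ?thesis .
qed

lemma isomorphic_trans:
  assumes "isomorphic C X Y" "isomorphic C Y Z"
  shows "isomorphic C X Z"
proof -
  obtain f f' where f: "f \<in> Hom C X Y" "f' \<in> Hom C Y X" "f' \<cdot> f = Id C X" "f \<cdot> f' = Id C Y"
    using assms(1) by (rule isomorphicE)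
  obtain g g' where g: "g \<in> Hom C Y Z" "g' \<in> Hom C Z Y" "g' \<cdot> g = Id C Y" "g \<cdot> g' = Id C Z"
    using assms(2) by (rule isomorphicE)
  show ?thesis
  proof (rule isomorphicI)
    show "g \<cdot> f \<in> Hom C X Z" "f' \<cdot> g' \<in> Hom C Z X"
      by (rule Comp_Hom[OF f(1) g(1)], rule Comp_Hom[OF g(2) f(2)])
    show "(f' \<cdot> g') \<cdot> (g \<cdot> f) = Id C X"
      using Comp_cancel_middle[OF f(1) g(1,2) f(2) g(3)] f(3) by simp
    show "(g \<cdot> f) \<cdot> (f' \<cdot> g') = Id C Z"
      using Comp_cancel_middle[OF g(2) f(2) f(1) g(1) f(4)] g(4) by simp
  qed
qed

lemma zero_objects_isomorphic:
  assumes "is_zero_object C Z" "is_zero_object C Z'"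
  shows "isomorphic C Z Z'"
proof -
  have Ob: "Z \<in> Ob C" "Z' \<in> Ob C"
    using assms unfolding is_zero_object_def by auto
  obtain f where f: "f \<in> Hom C Z Z'"
    using assms(2) Ob(1) unfolding is_zero_object_def by blast
  obtain g where g: "g \<in> Hom C Z' Z"
    using assms(1) Ob(2) unfolding is_zero_object_def by blast
  have "\<exists>!h. h \<in> Hom C Z Z" "\<exists>!h. h \<in> Hom C Z' Z'"
    using assms Ob unfolding is_zero_object_def by auto
  then have "g \<cdot> f = Id C Z" "f \<cdot> g = Id C Z'"
    using Comp_Hom[OF f g] Comp_Hom[OF g f] Id_Hom[OF Ob(1)] Id_Hom[OF Ob(2)] by (metis, metis)
  with f g show ?thesis by (rule isomorphicI)
qed

end


section \<open>Zero morphisms and signs in additive categories\<close>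

context additive_category
begin

lemma Zero_Hom: "X \<in> Ob C \<Longrightarrow> Y \<in> Ob C \<Longrightarrow> Zero C X Y \<in> Hom C X Y"
  using group.is_monoid[OF comm_group.axioms(2)[OF Hom_comm_group]] monoid.one_closed
  by (fastforce simp: Hom_group_def)

lemma Neg_Hom:
  assumes "f \<in> Hom C X Y"
  shows "Neg C f \<in> Hom C X Y"
proof -
  have "group (Hom_group C X Y)"
    using Hom_comm_group Hom_Ob[OF assms] comm_group.axioms(2) by blast
  then have "inv\<^bsub>Hom_group C X Y\<^esub> f \<in> Hom C X Y"
    using group.inv_closed[of "Hom_group C X Y" f] assms by (simp add: Hom_group_def)
  with assms show ?thesis unfolding Neg_def Hom_def by auto
qed

lemma Neg_Neg:
  assumes f: "f \<in> Hom C X Y"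
  shows "Neg C (Neg C f) = f"
proof -
  have "group (Hom_group C X Y)"
    using Hom_comm_group Hom_Ob[OF f] comm_group.axioms(2) by blast
  then have "inv\<^bsub>Hom_group C X Y\<^esub> (inv\<^bsub>Hom_group C X Y\<^esub> f) = f"
    using group.inv_inv[of "Hom_group C X Y" f] f by (simp add: Hom_group_def)
  with f Neg_Hom[OF f] show ?thesis unfolding Neg_def Hom_def by auto
qed

lemma Add_idem_imp_Zero:
  assumes f: "f \<in> Hom C X Y" and idem: "f \<oplus> f = f"
  shows "f = Zero C X Y"
proof -
  interpret G: group "Hom_group C X Y"
    using Hom_comm_group Hom_Ob[OF f] comm_group.axioms(2) by blast
  show ?thesis
    using G.l_cancel_one[of f f] f idem by (simp add: Hom_group_def)
qed

lemma Zero_Add_Zero: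
  assumes "X \<in> Ob C" "Y \<in> Ob C"
  shows "Zero C X Y \<oplus> Zero C X Y = Zero C X Y"
proof -
  interpret G: group "Hom_group C X Y"
    using Hom_comm_group assms comm_group.axioms(2) by blast
  show ?thesis
    using G.r_one[OF G.one_closed] by (simp add: Hom_group_def)
qed

lemma Comp_Zero:
  assumes "f \<in> Hom C Y Z" "X \<in> Ob C"
  shows "f \<cdot> Zero C X Y = Zero C X Z"
proof -
  have 0: "Zero C X Y \<in> Hom C X Y"
    using assms Zero_Hom Hom_Ob by blast
  show ?thesis
    using Add_idem_imp_Zero[OF Comp_Hom[OF 0 assms(1)]] Comp_Add_right[OF 0 0 assms(1)]
      Zero_Add_Zero Hom_Ob[OF 0] by simp
qed

lemma Zero_Comp:
  assumes "f \<in> Hom C X Y" "Z \<in> Ob C"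
  shows "Zero C Y Z \<cdot> f = Zero C X Z"
proof -
  have 0: "Zero C Y Z \<in> Hom C Y Z"
    using assms Zero_Hom Hom_Ob by blast
  show ?thesis
    using Add_idem_imp_Zero[OF Comp_Hom[OF assms(1) 0]] Comp_Add_left[OF assms(1) 0 0]
      Zero_Add_Zero Hom_Ob[OF 0] by simp
qed

lemma zero_object_if_Id_Zero:
  assumes Z: "Z \<in> Ob C" and Id: "Id C Z = Zero C Z Z"
  shows "is_zero_object C Z"
proof -
  have "f = Zero C X Z" if "f \<in> Hom C X Z" for f X
    using Id_Comp[OF that] Zero_Comp[OF that Z] Id by simp
  moreover have "f = Zero C Z X" if "f \<in> Hom C Z X" for f X
    using Comp_Id[OF that] Comp_Zero[OF that Z] Id by simp
  ultimately show ?thesis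
    unfolding is_zero_object_def using Z Zero_Hom by blast
qed

end


section \<open>The shift as an autoequivalence of triangles\<close>

context triangulated_category
begin

lemma Shift_Hom:
  assumes "f \<in> Hom T X Y"
  shows "Shift_ar T f \<in> Hom T (Shift T X) (Shift T Y)"
  by (rule bij_betw_apply[OF Shift_fully_faithful[OF Hom_Ob[OF assms]] assms])

lemma Shift_full:
  assumes "X \<in> Ob T" "Y \<in> Ob T" "f \<in> Hom T (Shift T X) (Shift T Y)"
  obtains g where "g \<in> Hom T X Y" "Shift_ar T g = f"
proof -
  have "f \<in> Shift_ar T ` Hom T X Y"
    using bij_betw_imp_surj_on[OF Shift_fully_faithful[OF assms(1,2)]] assms(3) by simp
  then show thesis by (rule imageE) (use that in simp)
qed

lemma Shift_faithful:
  assumes "f \<in> Hom T X Y" "g \<in> Hom T X Y" "Shift_ar T f = Shift_ar T g"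
  shows "f = g"
  by (rule inj_onD[OF bij_betw_imp_inj_on[OF Shift_fully_faithful[OF Hom_Ob[OF assms(1)]]]
        assms(3,1,2)])

lemma isomorphic_if_Shift_isomorphic:
  assumes Ob: "X \<in> Ob T" "Y \<in> Ob T" and iso: "isomorphic T (Shift T X) (Shift T Y)"
  shows "isomorphic T X Y"
proof -
  obtain u v where uv: "u \<in> Hom T (Shift T X) (Shift T Y)" "v \<in> Hom T (Shift T Y) (Shift T X)"
    "v \<cdot> u = Id T (Shift T X)" "u \<cdot> v = Id T (Shift T Y)"
    using iso by (rule isomorphicE)
  obtain f where f: "f \<in> Hom T X Y" "Shift_ar T f = u"
    by (rule Shift_full[OF Ob uv(1)])
  obtain g where g: "g \<in> Hom T Y X" "Shift_ar T g = v"
    by (rule Shift_full[OF Ob(2,1) uv(2)])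
  show ?thesis
  proof (rule isomorphicI[OF f(1) g(1)])
    show "g \<cdot> f = Id T X"
      by (rule Shift_faithful[OF Comp_Hom[OF f(1) g(1)] Id_Hom[OF Ob(1)]])
        (simp add: Shift_Comp[OF f(1) g(1)] Shift_Id[OF Ob(1)] f(2) g(2) uv(3))
    show "f \<cdot> g = Id T Y"
      by (rule Shift_faithful[OF Comp_Hom[OF g(1) f(1)] Id_Hom[OF Ob(2)]])
        (simp add: Shift_Comp[OF g(1) f(1)] Shift_Id[OF Ob(2)] f(2) g(2) uv(4))
  qed
qed

text \<open>The singleton \<open>Hom(Z, Z)\<close> maps onto \<open>Hom(\<Sigma>Z, \<Sigma>Z)\<close>, so the identity of \<open>\<Sigma>Z\<close> is its zero
  endomorphism.\<close>

lemma zero_object_Shift: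
  assumes "is_zero_object T Z"
  shows "is_zero_object T (Shift T Z)"
proof -
  have Z: "Z \<in> Ob T" and uniq: "\<And>f g. f \<in> Hom T Z Z \<Longrightarrow> g \<in> Hom T Z Z \<Longrightarrow> f = g"
    using assms unfolding is_zero_object_def by auto
  have \<Sigma>Z: "Shift T Z \<in> Ob T" using Z by (rule Shift_Ob)
  obtain f where "f \<in> Hom T Z Z" "Shift_ar T f = Id T (Shift T Z)"
    by (rule Shift_full[OF Z Z Id_Hom[OF \<Sigma>Z]])
  moreover obtain g where "g \<in> Hom T Z Z" "Shift_ar T g = Zero T (Shift T Z) (Shift T Z)"
    by (rule Shift_full[OF Z Z Zero_Hom[OF \<Sigma>Z \<Sigma>Z]])
  ultimately have "Id T (Shift T Z) = Zero T (Shift T Z) (Shift T Z)"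
    using uniq by metis
  then show ?thesis using \<Sigma>Z by (rule zero_object_if_Id_Zero[rotated])
qed

text \<open>Rotating three times returns to the same three morphisms, each shifted and negated.  As
  rotation is an equivalence, this transports distinguished triangles along \<open>\<Sigma>\<close> both ways.\<close>

lemma Dist_iff_neg_Shift_Dist:
  assumes f: "f \<in> Hom T X Y" and g: "g \<in> Hom T Y Z" and h: "h \<in> Hom T Z (Shift T X)"
  shows "(f, g, h) \<in> Dist T \<longleftrightarrow>
    (Neg T (Shift_ar T f), Neg T (Shift_ar T g), Neg T (Shift_ar T h)) \<in> Dist T"
proof -
  let ?f = "Neg T (Shift_ar T f)" and ?g = "Neg T (Shift_ar T g)"
  have f': "?f \<in> Hom T (Shift T X) (Shift T Y)" and g': "?g \<in> Hom T (Shift T Y) (Shift T Z)"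
    by (rule Neg_Hom[OF Shift_Hom[OF f]], rule Neg_Hom[OF Shift_Hom[OF g]])
  have "is_triangle T f g h" "is_triangle T g h ?f" "is_triangle T h ?f ?g"
    unfolding is_triangle_def using f g h f' g' by blast+
  from this[THEN TR2] show ?thesis by blast
qed

text \<open>Conjugating the three morphisms of a distinguished triangle by isomorphisms of its three
  objects gives an isomorphic triangle.\<close>

lemma Dist_transport:
  assumes D: "(f, g, h) \<in> Dist T"
    and f: "f \<in> Hom T X Y" and g: "g \<in> Hom T Y Z" and h: "h \<in> Hom T Z (Shift T X)"
    and iso: "isomorphic T X X'" "isomorphic T Y Y'" "isomorphic T Z Z'"
  obtains f' g' h' where "(f', g', h') \<in> Dist T"
    "f' \<in> Hom T X' Y'" "g' \<in> Hom T Y' Z'" "h' \<in> Hom T Z' (Shift T X')"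
proof -
  obtain a a' where a: "a \<in> Hom T X X'" "a' \<in> Hom T X' X" "a' \<cdot> a = Id T X" "a \<cdot> a' = Id T X'"
    using iso(1) by (rule isomorphicE)
  obtain b b' where b: "b \<in> Hom T Y Y'" "b' \<in> Hom T Y' Y" "b' \<cdot> b = Id T Y" "b \<cdot> b' = Id T Y'"
    using iso(2) by (rule isomorphicE)
  obtain c c' where c: "c \<in> Hom T Z Z'" "c' \<in> Hom T Z' Z" "c' \<cdot> c = Id T Z" "c \<cdot> c' = Id T Z'"
    using iso(3) by (rule isomorphicE)
  have bf: "b \<cdot> f \<in> Hom T X Y'" and cg: "c \<cdot> g \<in> Hom T Y Z'"
    and ah: "Shift_ar T a \<cdot> h \<in> Hom T Z (Shift T X')"
    by (rule Comp_Hom[OF f b(1)], rule Comp_Hom[OF g c(1)], rule Comp_Hom[OF h Shift_Hom[OF a(1)]])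
  let ?f = "(b \<cdot> f) \<cdot> a'" and ?g = "(c \<cdot> g) \<cdot> b'" and ?h = "(Shift_ar T a \<cdot> h) \<cdot> c'"
  have homs: "?f \<in> Hom T X' Y'" "?g \<in> Hom T Y' Z'" "?h \<in> Hom T Z' (Shift T X')"
    by (rule Comp_Hom[OF a(2) bf], rule Comp_Hom[OF b(2) cg], rule Comp_Hom[OF c(2) ah])
  have Dom: "Dom T f = X" "Dom T g = Y" "Dom T h = Z" "Dom T ?f = X'" "Dom T ?g = Y'" "Dom T ?h = Z'"
    using f g h homs unfolding Hom_def by auto
  have "(?f, ?g, ?h) \<in> Dist T"
  proof (rule TR1_iso[OF D])
    show "is_triangle T ?f ?g ?h"
      unfolding is_triangle_def using homs by blast
    show "a \<in> Hom T (Dom T f) (Dom T ?f)" "b \<in> Hom T (Dom T g) (Dom T ?g)"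
      "c \<in> Hom T (Dom T h) (Dom T ?h)"
      using Dom a b c by simp_all
    show "is_iso T a" "is_iso T b" "is_iso T c"
      using is_isoI[OF a] is_isoI[OF b] is_isoI[OF c] by simp_all
    show "b \<cdot> f = ?f \<cdot> a"
      using Comp_assoc[OF a(1) a(2) bf] a Comp_Id[OF bf] by simp
    show "c \<cdot> g = ?g \<cdot> b"
      using Comp_assoc[OF b(1) b(2) cg] b Comp_Id[OF cg] by simp
    show "Shift_ar T a \<cdot> h = ?h \<cdot> c"
      using Comp_assoc[OF c(1) c(2) ah] c Comp_Id[OF ah] by simp
  qed
  from that[OF this homs] show thesis .
qed

end


section \<open>Extension-closed subcategories\<close>

text \<open>The conditions that a metric imposes on each of its members separately, with an inclusion
  in place of the equality \<open>S * S = S\<close>.\<close>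

definition extension_closed ::
  "('o, 'a, 'z) triangulated_category_scheme \<Rightarrow> 'o set \<Rightarrow> bool" where
  "extension_closed T S \<longleftrightarrow>
    S \<subseteq> Ob T \<and> (\<forall>Z. is_zero_object T Z \<longrightarrow> Z \<in> S) \<and> star T S S \<subseteq> S"

lemma extension_closed_Int:
  assumes "extension_closed T S" "extension_closed T S'"
  shows "extension_closed T (S \<inter> S')"
proof -
  have "star T (S \<inter> S') (S \<inter> S') \<subseteq> star T S S \<inter> star T S' S'"
    unfolding star_def by blast
  with assms show ?thesis unfolding extension_closed_def by blast
qed

lemma shift_sub_mono: "S \<subseteq> S' \<Longrightarrow> shift_sub T S \<subseteq> shift_sub T S'"
  unfolding shift_sub_def by blast

lemma unshift_sub_mono: "S \<subseteq> S' \<Longrightarrow> unshift_sub T S \<subseteq> unshift_sub T S'"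
  unfolding unshift_sub_def by blast

context triangulated_category
begin

lemma extension_closedD:
  assumes "extension_closed T S" "(f, g, h) \<in> Dist T" "X \<in> S" "Z \<in> S"
    "f \<in> Hom T X Y" "g \<in> Hom T Y Z" "h \<in> Hom T Z (Shift T X)"
  shows "Y \<in> S"
  using assms unfolding extension_closed_def star_def by blast

text \<open>An isomorphism \<open>X \<rightarrow> Y\<close> makes \<open>Y\<close> an extension of \<open>0\<close> by \<open>X\<close>.\<close>

lemma isomorphic_in_star:
  assumes S: "extension_closed T S" and X: "X \<in> S" and iso: "isomorphic T X Y"
  shows "Y \<in> star T S S"
proof -
  obtain Z where Z: "is_zero_object T Z" using ex_zero_object by blast
  have Ob: "X \<in> Ob T" "Z \<in> Ob T" "Z \<in> S"
    using S X Z unfolding extension_closed_def is_zero_object_def by auto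
  obtain f g h where "(f, g, h) \<in> Dist T"
    "f \<in> Hom T X Y" "g \<in> Hom T Y Z" "h \<in> Hom T Z (Shift T X)"
    by (rule Dist_transport[OF TR1_id[OF Ob(1) Z] Id_Hom[OF Ob(1)] Zero_Hom[OF Ob(1,2)]
          Zero_Hom[OF Ob(2) Shift_Ob[OF Ob(1)]] isomorphic_refl[OF Ob(1)] iso
          isomorphic_refl[OF Ob(2)]])
  with X Ob show ?thesis unfolding star_def by blast
qed

lemma extension_closed_iso:
  assumes "extension_closed T S" "X \<in> S" "isomorphic T X Y"
  shows "Y \<in> S"
  using isomorphic_in_star[OF assms] assms(1) unfolding extension_closed_def by blast

lemma star_eq_if_extension_closed:
  assumes "extension_closed T S"
  shows "star T S S = S"
proof (rule subset_antisym)
  show "star T S S \<subseteq> S" using assms unfolding extension_closed_def by simp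
  show "S \<subseteq> star T S S"
  proof
    fix X assume X: "X \<in> S"
    then have "X \<in> Ob T" using assms unfolding extension_closed_def by auto
    then show "X \<in> star T S S" by (rule isomorphic_in_star[OF assms X isomorphic_refl])
  qed
qed

lemma unshift_sub_iff:
  assumes "extension_closed T S"
  shows "Y \<in> unshift_sub T S \<longleftrightarrow> Y \<in> Ob T \<and> Shift T Y \<in> S"
proof
  assume "Y \<in> unshift_sub T S"
  then obtain X where X: "X \<in> S" "isomorphic T (Shift T Y) X" and Y: "Y \<in> Ob T"
    unfolding unshift_sub_def by auto
  show "Y \<in> Ob T \<and> Shift T Y \<in> S"
    using Y extension_closed_iso[OF assms X(1) isomorphic_sym[OF X(2)]] by simp
next
  assume "Y \<in> Ob T \<and> Shift T Y \<in> S"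
  then show "Y \<in> unshift_sub T S"
    using isomorphic_refl[of "Shift T Y"] Shift_Ob[of Y] unfolding unshift_sub_def by auto
qed

lemma extension_closed_unshift_sub:
  assumes S: "extension_closed T S"
  shows "extension_closed T (unshift_sub T S)"
  unfolding extension_closed_def
proof (intro conjI allI impI subsetI)
  fix Y assume "Y \<in> unshift_sub T S"
  then show "Y \<in> Ob T" using unshift_sub_iff[OF S] by blast
next
  fix Z assume "is_zero_object T Z"
  then show "Z \<in> unshift_sub T S"
    using S zero_object_Shift[of Z] unshift_sub_iff[OF S, of Z]
    unfolding extension_closed_def by (auto simp: is_zero_object_def)
next
  fix Y assume "Y \<in> star T (unshift_sub T S) (unshift_sub T S)"
  then obtain X Z f g h where XZ: "X \<in> unshift_sub T S" "Z \<in> unshift_sub T S"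
    and D: "(f, g, h) \<in> Dist T"
    and homs: "f \<in> Hom T X Y" "g \<in> Hom T Y Z" "h \<in> Hom T Z (Shift T X)"
    unfolding star_def by blast
  have "Shift T Y \<in> S"
  proof (rule extension_closedD[OF S])
    show "(Neg T (Shift_ar T f), Neg T (Shift_ar T g), Neg T (Shift_ar T h)) \<in> Dist T"
      using Dist_iff_neg_Shift_Dist[OF homs] D by simp
    show "Shift T X \<in> S" "Shift T Z \<in> S"
      using XZ unshift_sub_iff[OF S] by auto
    show "Neg T (Shift_ar T f) \<in> Hom T (Shift T X) (Shift T Y)"
      "Neg T (Shift_ar T g) \<in> Hom T (Shift T Y) (Shift T Z)"
      "Neg T (Shift_ar T h) \<in> Hom T (Shift T Z) (Shift T (Shift T X))"
      by (rule Neg_Hom[OF Shift_Hom[OF homs(1)]], rule Neg_Hom[OF Shift_Hom[OF homs(2)]],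
          rule Neg_Hom[OF Shift_Hom[OF homs(3)]])
  qed
  then show "Y \<in> unshift_sub T S"
    using unshift_sub_iff[OF S, of Y] Hom_Ob[OF homs(1)] by simp
qed

text \<open>For the closure under extensions, the three objects of a triangle are replaced by
  isomorphic shifts and its morphisms are lifted along the full functor \<open>\<Sigma>\<close>.  Rotation reflects
  distinguishedness, so the lift is distinguished.\<close>

lemma extension_closed_shift_sub:
  assumes S: "extension_closed T S"
  shows "extension_closed T (shift_sub T S)"
  unfolding extension_closed_def
proof (intro conjI allI impI subsetI)
  fix Y assume "Y \<in> shift_sub T S"
  then show "Y \<in> Ob T" unfolding shift_sub_def by blast
next
  fix Z assume Z: "is_zero_object T Z"
  have "Z \<in> Ob T" "Z \<in> S"
    using S Z unfolding extension_closed_def is_zero_object_def by auto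
  then show "Z \<in> shift_sub T S"
    using zero_objects_isomorphic[OF Z zero_object_Shift[OF Z]] unfolding shift_sub_def by auto
next
  fix Y assume "Y \<in> star T (shift_sub T S) (shift_sub T S)"
  then obtain X Z f g h where XZ: "X \<in> shift_sub T S" "Z \<in> shift_sub T S"
    and D: "(f, g, h) \<in> Dist T"
    and homs: "f \<in> Hom T X Y" "g \<in> Hom T Y Z" "h \<in> Hom T Z (Shift T X)"
    unfolding star_def by blast
  obtain X' Z' where X': "X' \<in> S" "isomorphic T X (Shift T X')"
    and Z': "Z' \<in> S" "isomorphic T Z (Shift T Z')"
    using XZ unfolding shift_sub_def by blast
  have Y: "Y \<in> Ob T" using Hom_Ob[OF homs(1)] by simp
  obtain Y' where Y': "Y' \<in> Ob T" "isomorphic T Y (Shift T Y')"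
    using Shift_ess_surj[OF Y] by (auto dest: isomorphic_sym)
  have Ob: "X' \<in> Ob T" "Z' \<in> Ob T"
    using S X' Z' unfolding extension_closed_def by auto
  obtain u v w where D': "(u, v, w) \<in> Dist T" and uvw: "u \<in> Hom T (Shift T X') (Shift T Y')"
    "v \<in> Hom T (Shift T Y') (Shift T Z')" "w \<in> Hom T (Shift T Z') (Shift T (Shift T X'))"
    by (rule Dist_transport[OF D homs X'(2) Y'(2) Z'(2)])
  \<comment> \<open>The lifts are those of the negatives, which cancels the signs of the triple rotation.\<close>
  obtain f' where f': "f' \<in> Hom T X' Y'" "Shift_ar T f' = Neg T u"
    by (rule Shift_full[OF Ob(1) Y'(1) Neg_Hom[OF uvw(1)]])
  obtain g' where g': "g' \<in> Hom T Y' Z'" "Shift_ar T g' = Neg T v"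
    by (rule Shift_full[OF Y'(1) Ob(2) Neg_Hom[OF uvw(2)]])
  obtain h' where h': "h' \<in> Hom T Z' (Shift T X')" "Shift_ar T h' = Neg T w"
    by (rule Shift_full[OF Ob(2) Shift_Ob[OF Ob(1)] Neg_Hom[OF uvw(3)]])
  have "(f', g', h') \<in> Dist T"
    using Dist_iff_neg_Shift_Dist[OF f'(1) g'(1) h'(1)] D' f'(2) g'(2) h'(2)
      Neg_Neg[OF uvw(1)] Neg_Neg[OF uvw(2)] Neg_Neg[OF uvw(3)] by simp
  from extension_closedD[OF S this X'(1) Z'(1) f'(1) g'(1) h'(1)] have "Y' \<in> S" .
  with Y Y' show "Y \<in> shift_sub T S" unfolding shift_sub_def by blast
qed

text \<open>\<open>\<Sigma>\<close> and \<open>\<Sigma>\<^sup>-\<^sup>1\<close> are mutually inverse on isomorphism-closed subcategories.  Hence \<open>S \<subseteq> \<Sigma>S'\<close> is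
  equivalent to \<open>\<Sigma>\<^sup>-\<^sup>1S \<subseteq> S'\<close>, and likewise with \<open>\<Sigma>\<close> and \<open>\<Sigma>\<^sup>-\<^sup>1\<close> exchanged.  The two implications that
  conclude \<open>\<dots> \<subseteq> S'\<close> make the improvement good, the two converses make it coarsest.\<close>

lemma shift_sub_subset_if_subset_unshift_sub:
  assumes S': "extension_closed T S'" and sub: "S \<subseteq> unshift_sub T S'"
  shows "shift_sub T S \<subseteq> S'"
proof
  fix Y assume "Y \<in> shift_sub T S"
  then obtain X where X: "X \<in> S" "isomorphic T Y (Shift T X)"
    unfolding shift_sub_def by auto
  then have "Shift T X \<in> S'" using sub unshift_sub_iff[OF S', of X] by auto
  then show "Y \<in> S'" by (rule extension_closed_iso[OF S' _ isomorphic_sym[OF X(2)]])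
qed

lemma unshift_sub_subset_if_subset_shift_sub:
  assumes S': "extension_closed T S'" and sub: "S \<subseteq> shift_sub T S'"
  shows "unshift_sub T S \<subseteq> S'"
proof
  fix Y assume "Y \<in> unshift_sub T S"
  then obtain X where Y: "Y \<in> Ob T" and "X \<in> S" and YX: "isomorphic T (Shift T Y) X"
    unfolding unshift_sub_def by blast
  then obtain W where W: "W \<in> S'" "isomorphic T X (Shift T W)"
    using sub unfolding shift_sub_def by blast
  have "W \<in> Ob T" using W(1) S' unfolding extension_closed_def by auto
  then have "isomorphic T Y W"
    by (rule isomorphic_if_Shift_isomorphic[OF Y _ isomorphic_trans[OF YX W(2)]])
  then show "Y \<in> S'"
    by (rule extension_closed_iso[OF S' W(1) isomorphic_sym])
qed

lemma subset_unshift_sub_if_shift_sub_subset: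
  assumes S: "S \<subseteq> Ob T" and sub: "shift_sub T S \<subseteq> S'"
  shows "S \<subseteq> unshift_sub T S'"
proof
  fix Y assume Y: "Y \<in> S"
  then have Ob: "Y \<in> Ob T" "Shift T Y \<in> Ob T" using S Shift_Ob by auto
  have refl: "isomorphic T (Shift T Y) (Shift T Y)" using Ob(2) by (rule isomorphic_refl)
  with Y Ob have "Shift T Y \<in> shift_sub T S" unfolding shift_sub_def by auto
  with sub refl Ob show "Y \<in> unshift_sub T S'" unfolding unshift_sub_def by auto
qed

lemma subset_shift_sub_if_unshift_sub_subset:
  assumes S: "S \<subseteq> Ob T" and sub: "unshift_sub T S \<subseteq> S'"
  shows "S \<subseteq> shift_sub T S'"
proof
  fix Y assume Y: "Y \<in> S"
  then have Ob: "Y \<in> Ob T" using S by auto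
  obtain W where W: "W \<in> Ob T" "isomorphic T (Shift T W) Y"
    using Shift_ess_surj[OF Ob] by auto
  then have "W \<in> unshift_sub T S" using Y unfolding unshift_sub_def by auto
  then show "Y \<in> shift_sub T S'"
    using Ob sub isomorphic_sym[OF W(2)] unfolding shift_sub_def by auto
qed

lemma is_metric_iff:
  "is_metric T B \<longleftrightarrow> (\<forall>n \<ge> 1. extension_closed T (B n) \<and> B (n + 1) \<subseteq> B n)"
proof -
  have "extension_closed T S \<longleftrightarrow>
      S \<subseteq> Ob T \<and> star T S S = S \<and> (\<forall>Z. is_zero_object T Z \<longrightarrow> Z \<in> S)" for S
    using star_eq_if_extension_closed[of S] unfolding extension_closed_def by auto
  then show ?thesis unfolding is_metric_def by auto
qed


section \<open>The improvement of a metric\<close>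

lemma improvement_Suc:
  "n \<ge> 1 \<Longrightarrow> improvement T B (Suc n) =
    B (Suc n) \<inter> shift_sub T (improvement T B n) \<inter> unshift_sub T (improvement T B n)"
  by (cases n) auto

lemma extension_closed_improvement:
  assumes "is_metric T B" "n \<ge> 1"
  shows "extension_closed T (improvement T B n)"
  using assms(2)
proof (induction n rule: dec_induct)
  case base
  then show ?case using assms(1) by (simp add: is_metric_iff)
next
  case (step n)
  have "extension_closed T (B (Suc n))"
    using assms(1) unfolding is_metric_iff by simp
  with step show ?case
    by (simp add: improvement_Suc extension_closed_Int extension_closed_shift_sub
        extension_closed_unshift_sub)
qed

lemma improvement_subset: "n \<ge> 1 \<Longrightarrow> improvement T B n \<subseteq> B n"
  by (induction n rule: dec_induct) (auto simp: improvement_Suc)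

lemma improvement_decreasing:
  assumes "is_metric T B" "n \<ge> 1"
  shows "improvement T B (Suc n) \<subseteq> improvement T B n"
  using assms(2)
proof (induction n rule: dec_induct)
  case base
  have "B (Suc 1) \<subseteq> B 1" using assms(1) unfolding is_metric_def by simp
  then show ?case by (auto simp: improvement_Suc)
next
  case (step n)
  have "B (Suc (Suc n)) \<subseteq> B (Suc n)" using assms(1) unfolding is_metric_def by simp
  moreover note shift_sub_mono[OF step.IH] unshift_sub_mono[OF step.IH]
  ultimately have "B (Suc (Suc n)) \<inter> shift_sub T (improvement T B (Suc n)) \<inter>
      unshift_sub T (improvement T B (Suc n)) \<subseteq>
      B (Suc n) \<inter> shift_sub T (improvement T B n) \<inter> unshift_sub T (improvement T B n)"
    by blast
  then show ?case
    using step.hyps improvement_Suc[of n B] improvement_Suc[of "Suc n" B] by simp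
qed

lemma is_good_metric_improvement:
  assumes B: "is_metric T B"
  shows "is_good_metric T (improvement T B)"
  unfolding is_good_metric_def
proof (intro conjI allI impI)
  show "is_metric T (improvement T B)"
    unfolding is_metric_iff
    using extension_closed_improvement[OF B] improvement_decreasing[OF B] by simp
next
  fix n :: nat assume n: "n \<ge> 1"
  let ?C = "improvement T B"
  have closed: "extension_closed T (?C n)"
    using extension_closed_improvement[OF B n] .
  have "?C (n + 1) \<subseteq> shift_sub T (?C n)" "?C (n + 1) \<subseteq> unshift_sub T (?C n)"
    using improvement_Suc[OF n] by auto
  then have "unshift_sub T (?C (n + 1)) \<subseteq> ?C n" "shift_sub T (?C (n + 1)) \<subseteq> ?C n"
    using unshift_sub_subset_if_subset_shift_sub[OF closed]
      shift_sub_subset_if_subset_unshift_sub[OF closed] by auto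
  moreover have "?C (n + 1) \<subseteq> ?C n"
    using improvement_decreasing[OF B n] by simp
  ultimately show "unshift_sub T (?C (n + 1)) \<union> ?C (n + 1) \<union> shift_sub T (?C (n + 1)) \<subseteq> ?C n"
    by blast
qed

lemma is_metric_antimono:
  assumes "is_metric T D" "1 \<le> m" "m \<le> k"
  shows "D k \<subseteq> D m"
  using assms(3,2)
proof (induction k rule: dec_induct)
  case (step k)
  then have "D (k + 1) \<subseteq> D k" using assms(1) unfolding is_metric_def by simp
  with step show ?case by auto
qed simp

lemma good_metric_finer_improvement:
  assumes D: "is_good_metric T D" and fin: "finer D B"
  shows "finer D (improvement T B)"
  unfolding finer_def
proof (intro allI impI)
  have metric: "is_metric T D" using D unfolding is_good_metric_def by simp
  fix n :: nat assume "n \<ge> 1"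
  then show "\<exists>m \<ge> 1. D m \<subseteq> improvement T B n"
  proof (induction n rule: dec_induct)
    case base
    then show ?case using fin unfolding finer_def by simp
  next
    case (step n)
    then obtain m where m: "m \<ge> 1" "D m \<subseteq> improvement T B n" by blast
    obtain k where k: "k \<ge> 1" "D k \<subseteq> B (Suc n)"
      using fin[unfolded finer_def, rule_format, of "Suc n"] by auto
    have Ob: "D (m + 1) \<subseteq> Ob T"
      using metric[unfolded is_metric_def, rule_format, of "m + 1"] by simp
    have "unshift_sub T (D (m + 1)) \<subseteq> D m" "shift_sub T (D (m + 1)) \<subseteq> D m"
      using D m(1) unfolding is_good_metric_def by simp_all
    with m(2) have "D (m + 1) \<subseteq> shift_sub T (improvement T B n)"
      "D (m + 1) \<subseteq> unshift_sub T (improvement T B n)"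
      using subset_shift_sub_if_unshift_sub_subset[OF Ob]
        subset_unshift_sub_if_shift_sub_subset[OF Ob] by simp_all
    moreover have "D (max (m + 1) k) \<subseteq> D (m + 1)" "D (max (m + 1) k) \<subseteq> D k"
      using is_metric_antimono[OF metric] k(1) by auto
    ultimately have "D (max (m + 1) k) \<subseteq> improvement T B (Suc n)"
      using k(2) unfolding improvement_Suc[OF step.hyps(1)] by auto
    then show ?case using k(1) by (intro exI[of _ "max (m + 1) k"]) auto
  qed
qed

end

theorem proposition5p7:
  fixes T :: "('o, 'a, 'z) triangulated_category_scheme"
    and B :: "nat \<Rightarrow> 'o set"
  assumes "triangulated_category T"
    and "is_metric T B"
  shows "is_good_metric T (improvement T B) \<and>
    finer (improvement T B) B \<and>
    (\<forall>D. is_good_metric T D \<and> finer D B \<longrightarrow> finer D (improvement T B))"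
proof -
  interpret triangulated_category T by fact
  have "finer (improvement T B) B"
    unfolding finer_def using improvement_subset by metis
  then show ?thesis
    using is_good_metric_improvement[OF assms(2)] good_metric_finer_improvement by simp
qed

end
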